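(* Let $\Delta$ be a pure tree of dimension $d$. Then the following are equivalent: (i) for all faces $G\in\Delta$ with $\dim G\leq d-2$, the link $\operatorname{lk}_\Delta G$ is connected; (ii) $\Delta$ is connected in codimension $1$.
   Context: A simplicial complex $\Delta$ on a finite vertex set $V$ is a collection of subsets of $V$ containing all singletons $\{v\}$, $v\in V$, and closed under taking subsets (including $\emptyset$). Elements of $\Delta$ are faces, $\dim F=|F|-1$ (so $\dim\emptyset=-1$); facets are the maximal faces, $\mathcal F(\Delta)$ is the set of facets, and $\langle F_1,\dots,F_q\rangle$ denotes the complex with facets $F_1,\dots,F_q$. $\dim\Delta$ is the maximal dimension of a facet; $\Delta$ is pure if all facets have the same dimension. A subcomplex of $\Delta$ is a simplicial complex $\Gamma$ with $\mathcal F(\Gamma)\subseteq\mathcal F(\Delta)$. A chain between facets $F$ and $G$ is a sequence of facets $F=F_0,\dots,F_n=G$ with $F_i\cap F_{i+1}\neq\emptyset$ for all $i=0,\dots,n-1$. It is a proper chain if moreover $\dim(F_i\cap F_{i+1})=\dim(F_{i+1})-1$ for all $i$. $\Delta$ is connected if there is a chain between any two facets; it is connected in codimension $1$ if for any two facets $F,G$ with $\dim F\ge\dim G$ there is a proper chain between $F$ and $G$. A facet $F$ of $\Delta$ is a leaf if either $F$ is the only facet of $\Delta$, or there is a facet $G\ne F$ of $\Delta$ such that $F\cap H\subseteq F\cap G$ for every facet $H\neq F$. A tree is a connected simplicial complex every nonempty subcomplex of which has a leaf. For $G\in\Delta$, the link is the simplicial complex $\operatorname{lk}_\Delta G=\{H\in\Delta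 : G\cup H\in\Delta,\ G\cap H=\emptyset\}$. *)

theory Defs
  imports Main
begin

definition simplicial_complex :: "'a set \<Rightarrow> 'a set set \<Rightarrow> bool" where
  "simplicial_complex V \<Delta> \<longleftrightarrow>
     finite V \<and> \<Delta> \<subseteq> Pow V \<and> (\<forall>v\<in>V. {v} \<in> \<Delta>) \<and> {} \<in> \<Delta> \<and>
     (\<forall>F\<in>\<Delta>. \<forall>G. G \<subseteq> F \<longrightarrow> G \<in> \<Delta>)"

text \<open>Dimensions are integers because the empty face has dimension $-1$.\<close>

definition face_dim :: "'a set \<Rightarrow> int" where
  "face_dim F = int (card F) - 1"

definition facets :: "'a set set \<Rightarrow> 'a set set" where
  "facets \<Delta> = {F \<in> \<Delta>. \<forall>G\<in>\<Delta>. F \<subseteq> G \<longrightarrow> G = F}"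

definition complex_dim :: "'a set set \<Rightarrow> int" where
  "complex_dim \<Delta> = Max (face_dim ` facets \<Delta>)"

definition pure_complex :: "'a set set \<Rightarrow> bool" where
  "pure_complex \<Delta> \<longleftrightarrow> (\<forall>F\<in>facets \<Delta>. \<forall>G\<in>facets \<Delta>. face_dim F = face_dim G)"

text \<open>A subcomplex lives on its own vertex set, which may be smaller than that of the
  ambient complex.\<close>

definition subcomplex :: "'a set set \<Rightarrow> 'a set set \<Rightarrow> bool" where
  "subcomplex \<Gamma> \<Delta> \<longleftrightarrow> (\<exists>W. simplicial_complex W \<Gamma>) \<and> facets \<Gamma> \<subseteq> facets \<Delta>"

text \<open>A chain $F_0, \dots, F_n$ is a nonempty list, so $n = 0$ (with $F = G$) is allowed.\<close>

definition facet_chain :: "'a set set \<Rightarrow> 'a set \<Rightarrow> 'a set \<Rightarrow> 'a set list \<Rightarrow> bool" where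
  "facet_chain \<Delta> F G Fs \<longleftrightarrow>
     Fs \<noteq> [] \<and> hd Fs = F \<and> last Fs = G \<and> set Fs \<subseteq> facets \<Delta> \<and>
     (\<forall>i. Suc i < length Fs \<longrightarrow> Fs ! i \<inter> Fs ! Suc i \<noteq> {})"

definition proper_facet_chain :: "'a set set \<Rightarrow> 'a set \<Rightarrow> 'a set \<Rightarrow> 'a set list \<Rightarrow> bool" where
  "proper_facet_chain \<Delta> F G Fs \<longleftrightarrow>
     facet_chain \<Delta> F G Fs \<and>
     (\<forall>i. Suc i < length Fs \<longrightarrow>
        face_dim (Fs ! i \<inter> Fs ! Suc i) = face_dim (Fs ! Suc i) - 1)"

definition connected_complex :: "'a set set \<Rightarrow> bool" where
  "connected_complex \<Delta> \<longleftrightarrow>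
     (\<forall>F\<in>facets \<Delta>. \<forall>G\<in>facets \<Delta>. \<exists>Fs. facet_chain \<Delta> F G Fs)"

definition connected_in_codim_1 :: "'a set set \<Rightarrow> bool" where
  "connected_in_codim_1 \<Delta> \<longleftrightarrow>
     (\<forall>F\<in>facets \<Delta>. \<forall>G\<in>facets \<Delta>. face_dim F \<ge> face_dim G \<longrightarrow>
        (\<exists>Fs. proper_facet_chain \<Delta> F G Fs))"

definition is_leaf :: "'a set set \<Rightarrow> 'a set \<Rightarrow> bool" where
  "is_leaf \<Delta> F \<longleftrightarrow>
     F \<in> facets \<Delta> \<and>
     (facets \<Delta> = {F} \<or>
      (\<exists>G\<in>facets \<Delta>. G \<noteq> F \<and> (\<forall>H\<in>facets \<Delta>. H \<noteq> F \<longrightarrow> F \<inter> H \<subseteq> F \<inter> G)))"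

definition simplicial_tree :: "'a set \<Rightarrow> 'a set set \<Rightarrow> bool" where
  "simplicial_tree V \<Delta> \<longleftrightarrow>
     simplicial_complex V \<Delta> \<and> connected_complex \<Delta> \<and>
     (\<forall>\<Gamma>. subcomplex \<Gamma> \<Delta> \<and> \<Gamma> \<noteq> {} \<longrightarrow> (\<exists>F. is_leaf \<Gamma> F))"

definition link :: "'a set set \<Rightarrow> 'a set \<Rightarrow> 'a set set" where
  "link \<Delta> G = {H \<in> \<Delta>. G \<union> H \<in> \<Delta> \<and> G \<inter> H = {}}"

lemma simplicial_complex_link:
  assumes "simplicial_complex V \<Delta>" and "G \<in> \<Delta>"
  shows "simplicial_complex (\<Union> (link \<Delta> G)) (link \<Delta> G)"
proof -
  have down: "A \<in> \<Delta>" if "B \<in> \<Delta>" "A \<subseteq> B" for A B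
    using assms(1) that unfolding simplicial_complex_def by blast
  have closed: "A \<in> link \<Delta> G" if "B \<in> link \<Delta> G" "A \<subseteq> B" for A B
  proof -
    have "G \<union> A \<in> \<Delta>" using that down[of "G \<union> B" "G \<union> A"] by (auto simp: link_def)
    then show ?thesis using that down[of B A] by (auto simp: link_def)
  qed
  have "\<Union> (link \<Delta> G) \<subseteq> V" "finite V" "{} \<in> \<Delta>"
    using assms(1) by (auto simp: simplicial_complex_def link_def)
  moreover have "{} \<in> link \<Delta> G" using assms(2) \<open>{} \<in> \<Delta>\<close> by (simp add: link_def)
  moreover have "{v} \<in> link \<Delta> G" if "v \<in> \<Union> (link \<Delta> G)" for v
    using that closed by blast
  ultimately show ?thesis
    unfolding simplicial_complex_def using closed by (auto intro: finite_subset)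
qed

end

theory Submission imports Defs begin

text \<open>
  The facets of the link of \<open>G\<close> are the sets \<open>F - G\<close> for facets \<open>F \<supseteq> G\<close>, so everything can be
  phrased for the family of facets.

  If the links are connected, then facets \<open>A\<close>, \<open>B\<close> with \<open>A \<inter> B\<close> too small are joined by a chain in
  the star of \<open>A \<inter> B\<close> whose successive intersections are strictly larger than \<open>A \<inter> B\<close>; iterating
  this refinement yields a proper chain.

  Conversely, let \<open>F\<close> be a leaf with joint \<open>J\<close>. Connectedness in codimension 1 makes \<open>F \<inter> J\<close> a
  codimension 1 face of \<open>F\<close> which contains, hence equals, \<open>F \<inter> A\<close> for every neighbour \<open>A\<close> of \<open>F\<close>.
  Chains through \<open>F\<close> can thus be rerouted through \<open>J\<close>, so \<open>F\<close> can be deleted. By induction on the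
  number of facets, the star of every \<open>G\<close> is connected by proper chains; if \<open>F\<close> lies in the star
  together with another facet, then so does \<open>J\<close>.
\<close>

section \<open>Reachability inside a family of sets\<close>

definition connected_by :: "('a \<Rightarrow> 'a \<Rightarrow> bool) \<Rightarrow> 'a set \<Rightarrow> bool" where
  "connected_by R S \<longleftrightarrow> (\<forall>A\<in>S. \<forall>B\<in>S. (\<lambda>X Y. X \<in> S \<and> Y \<in> S \<and> R X Y)\<^sup>*\<^sup>* A B)"

text \<open>Chains given as lists become paths of a closure, so that rule induction applies to them.
  The conjunct \<open>A \<in> S\<close> matters only for the trivial path: the closure is reflexive
  even outside \<open>S\<close>, whereas a one-element chain must lie in \<open>S\<close>.\<close>

lemma rtranclp_iff_ex_list:
  "A \<in> S \<and> (\<lambda>X Y. X \<in> S \<and> Y \<in> S \<and> R X Y)\<^sup>*\<^sup>* A B \<longleftrightarrow>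
   (\<exists>xs. xs \<noteq> [] \<and> hd xs = A \<and> last xs = B \<and> set xs \<subseteq> S \<and>
      (\<forall>i. Suc i < length xs \<longrightarrow> R (xs ! i) (xs ! Suc i)))"
  (is "?L \<longleftrightarrow> ?R")
proof
  assume L: ?L
  then have "(\<lambda>X Y. X \<in> S \<and> Y \<in> S \<and> R X Y)\<^sup>*\<^sup>* A B" ..
  then show ?R
  proof (induction rule: converse_rtranclp_induct)
    case base
    from L have "B \<in> S" by (auto elim: rtranclp.cases)
    then show ?case by (intro exI[of _ "[B]"]) simp
  next
    case (step X Y)
    then obtain xs where "xs \<noteq> []" "hd xs = Y" "last xs = B" "set xs \<subseteq> S"
      "\<forall>i. Suc i < length xs \<longrightarrow> R (xs ! i) (xs ! Suc i)" by blast
    with step(1) show ?case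
      by (intro exI[of _ "X # xs"]) (auto simp: nth_Cons hd_conv_nth split: nat.split)
  qed
next
  assume ?R
  then obtain xs where "xs \<noteq> []" "hd xs = A" "last xs = B" "set xs \<subseteq> S"
    "\<forall>i. Suc i < length xs \<longrightarrow> R (xs ! i) (xs ! Suc i)" by blast
  then show ?L
  proof (induction xs arbitrary: A)
    case (Cons X xs)
    show ?case
    proof (cases xs)
      case Nil
      with Cons.prems show ?thesis by auto
    next
      case (Cons Y ys)
      have R: "R (xs ! i) (xs ! Suc i)" if "Suc i < length xs" for i
        using Cons.prems(5)[rule_format, of "Suc i"] that by simp
      have "Y \<in> S \<and> (\<lambda>X Y. X \<in> S \<and> Y \<in> S \<and> R X Y)\<^sup>*\<^sup>* Y B"
        by (rule Cons.IH) (use Cons.prems(3,4) Cons R in simp_all)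
      moreover have "R X Y" using Cons.prems(5)[rule_format, of 0] Cons by simp
      ultimately show ?thesis
        using Cons.prems(2,4) by (auto intro: converse_rtranclp_into_rtranclp)
    qed
  qed simp
qed

lemma connected_by_mono:
  assumes "connected_by R S" and "\<And>A B. A \<in> S \<Longrightarrow> B \<in> S \<Longrightarrow> R A B \<Longrightarrow> Q A B"
  shows "connected_by Q S"
proof -
  have "(\<lambda>X Y. X \<in> S \<and> Y \<in> S \<and> R X Y)\<^sup>*\<^sup>* \<le> (\<lambda>X Y. X \<in> S \<and> Y \<in> S \<and> Q X Y)\<^sup>*\<^sup>*"
    by (rule rtranclp_mono) (use assms(2) in blast)
  with assms(1) show ?thesis unfolding connected_by_def by blast
qed

text \<open>Steps are allowed to collapse under \<open>f\<close>. This is what later permits folding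
  a leaf onto its joint without breaking paths.\<close>

lemma connected_by_image:
  assumes "connected_by R S"
    and "\<And>A B. A \<in> S \<Longrightarrow> B \<in> S \<Longrightarrow> R A B \<Longrightarrow> f A = f B \<or> Q (f A) (f B)"
  shows "connected_by Q (f ` S)"
proof -
  have "(\<lambda>X Y. X \<in> f ` S \<and> Y \<in> f ` S \<and> Q X Y)\<^sup>*\<^sup>* (f A) (f B)"
    if "(\<lambda>X Y. X \<in> S \<and> Y \<in> S \<and> R X Y)\<^sup>*\<^sup>* A B" for A B
    using that
  proof (induction rule: rtranclp_induct)
    case (step X Y)
    then have "f X = f Y \<or> (f X \<in> f ` S \<and> f Y \<in> f ` S \<and> Q (f X) (f Y))"
      using assms(2) by auto
    with step.IH show ?case by (auto intro: rtranclp.rtrancl_into_rtrancl)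
  qed simp
  with assms(1) show ?thesis by (auto simp: connected_by_def)
qed

lemma connected_by_image_iff:
  assumes "inj_on f S"
  shows "connected_by R (f ` S) \<longleftrightarrow> connected_by (\<lambda>A B. R (f A) (f B)) S"
proof
  assume "connected_by R (f ` S)"
  then have "connected_by (\<lambda>A B. R (f A) (f B)) (the_inv_into S f ` f ` S)"
    by (rule connected_by_image) (auto simp: the_inv_into_f_f[OF assms])
  moreover have "the_inv_into S f ` f ` S = S"
    using the_inv_into_f_f[OF assms] by force
  ultimately show "connected_by (\<lambda>A B. R (f A) (f B)) S" by simp
qed (erule connected_by_image, simp)

section \<open>Chains, links and subcomplexes in terms of facets\<close>

lemma connected_complex_iff:
  "connected_complex \<Delta> \<longleftrightarrow> connected_by (\<lambda>A B. A \<inter> B \<noteq> {}) (facets \<Delta>)"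
proof -
  have "(\<exists>Fs. facet_chain \<Delta> A B Fs) \<longleftrightarrow> A \<in> facets \<Delta> \<and>
      (\<lambda>X Y. X \<in> facets \<Delta> \<and> Y \<in> facets \<Delta> \<and> X \<inter> Y \<noteq> {})\<^sup>*\<^sup>* A B" for A B
    unfolding rtranclp_iff_ex_list facet_chain_def ..
  then show ?thesis by (simp add: connected_complex_def connected_by_def)
qed

text \<open>Purity makes the condition on the dimensions of the two end facets hold for every pair,
  so the definition becomes plain reachability.\<close>

lemma connected_in_codim_1_iff:
  assumes "pure_complex \<Delta>"
  shows "connected_in_codim_1 \<Delta> \<longleftrightarrow>
    connected_by (\<lambda>A B. A \<inter> B \<noteq> {} \<and> Suc (card (A \<inter> B)) = card B) (facets \<Delta>)"
proof -
  have dim: "face_dim (A \<inter> B) = face_dim B - 1 \<longleftrightarrow> Suc (card (A \<inter> B)) = card B"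
    for A B :: "'a set" by (auto simp: face_dim_def)
  have "(\<exists>Fs. proper_facet_chain \<Delta> A B Fs) \<longleftrightarrow> A \<in> facets \<Delta> \<and>
      (\<lambda>X Y. X \<in> facets \<Delta> \<and> Y \<in> facets \<Delta> \<and>
        X \<inter> Y \<noteq> {} \<and> Suc (card (X \<inter> Y)) = card Y)\<^sup>*\<^sup>* A B" for A B
    unfolding rtranclp_iff_ex_list proper_facet_chain_def facet_chain_def dim
    by (simp add: conj_assoc imp_conjR all_conj_distrib)
  moreover have "face_dim B \<le> face_dim A" if "A \<in> facets \<Delta>" "B \<in> facets \<Delta>" for A B
    using assms that unfolding pure_complex_def by (metis order_refl)
  ultimately show ?thesis by (simp add: connected_in_codim_1_def connected_by_def)
qed

lemma ex_facet_superset: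
  assumes "simplicial_complex V \<Delta>" "A \<in> \<Delta>"
  obtains F where "F \<in> facets \<Delta>" "A \<subseteq> F"
proof -
  have "finite \<Delta>"
    using assms(1) by (auto simp: simplicial_complex_def intro: finite_subset)
  then obtain F where "F \<in> \<Delta>" "A \<subseteq> F" "\<forall>B\<in>\<Delta>. F \<subseteq> B \<longrightarrow> F = B"
    using finite_has_maximal2[of \<Delta> A] assms(2) by auto
  with that show ?thesis by (auto simp: facets_def)
qed

text \<open>A face \<open>H\<close> of the link corresponds to the face \<open>G \<union> H\<close>
  of the complex, and this correspondence respects inclusion, so maximality transfers in both
  directions.\<close>

lemma facets_link:
  assumes "simplicial_complex V \<Delta>"
  shows "facets (link \<Delta> G) = (\<lambda>F. F - G) ` {F \<in> facets \<Delta>. G \<subseteq> F}"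
proof (intro set_eqI iffI)
  have down: "A \<in> \<Delta>" if "B \<in> \<Delta>" "A \<subseteq> B" for A B
    using assms that unfolding simplicial_complex_def by blast
  have mem: "F - G \<in> link \<Delta> G" if "F \<in> \<Delta>" "G \<subseteq> F" for F
  proof -
    have "G \<union> (F - G) = F" using that by blast
    with that down[of F "F - G"] show ?thesis by (auto simp: link_def)
  qed
  fix H
  {
    assume H: "H \<in> facets (link \<Delta> G)"
    then have "G \<union> H \<in> \<Delta>" "G \<inter> H = {}" by (auto simp: facets_def link_def)
    then obtain F where F: "F \<in> facets \<Delta>" "G \<union> H \<subseteq> F"
      using ex_facet_superset assms by metis
    then have "H \<subseteq> F - G" "F - G \<in> link \<Delta> G"
      using \<open>G \<inter> H = {}\<close> mem by (auto simp: facets_def)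
    with H have "H = F - G" by (auto simp: facets_def)
    with F show "H \<in> (\<lambda>F. F - G) ` {F \<in> facets \<Delta>. G \<subseteq> F}" by blast
  next
    assume "H \<in> (\<lambda>F. F - G) ` {F \<in> facets \<Delta>. G \<subseteq> F}"
    then obtain F where F: "F \<in> facets \<Delta>" "G \<subseteq> F" and H: "H = F - G" by blast
    have "K = H" if "K \<in> link \<Delta> G" "H \<subseteq> K" for K
    proof -
      have "F \<subseteq> G \<union> K" "G \<union> K \<in> \<Delta>" "G \<inter> K = {}"
        using that H by (auto simp: link_def)
      moreover from this F(1) have "G \<union> K = F" unfolding facets_def by blast
      ultimately show ?thesis using H by blast
    qed
    with F H mem show "H \<in> facets (link \<Delta> G)" by (simp add: facets_def)
  }
qed

lemma connected_complex_link_iff: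
  assumes "simplicial_complex V \<Delta>"
  shows "connected_complex (link \<Delta> G) \<longleftrightarrow>
    connected_by (\<lambda>A B. \<not> A \<inter> B \<subseteq> G) {F \<in> facets \<Delta>. G \<subseteq> F}"
proof -
  have "inj_on (\<lambda>F. F - G) {F \<in> facets \<Delta>. G \<subseteq> F}"
    by (rule inj_onI) blast
  moreover have "(A - G) \<inter> (B - G) \<noteq> {} \<longleftrightarrow> \<not> A \<inter> B \<subseteq> G" for A B by blast
  ultimately show ?thesis
    by (simp add: connected_complex_iff facets_link[OF assms] connected_by_image_iff)
qed

text \<open>Facets form an antichain, so each member of \<open>T\<close> stays maximal. Hence the
  leaf condition on subcomplexes applies to every nonempty set of facets.\<close>

lemma subcomplex_spanned_by_facets:
  assumes "simplicial_complex V \<Delta>" "T \<subseteq> facets \<Delta>" "T \<noteq> {}"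
  defines "\<Gamma> \<equiv> {A. \<exists>F\<in>T. A \<subseteq> F}"
  shows "facets \<Gamma> = T" and "subcomplex \<Gamma> \<Delta>"
proof -
  have anti: "F = G" if "F \<in> T" "G \<in> T" "F \<subseteq> G" for F G
    using assms(2) that unfolding facets_def by blast
  show *: "facets \<Gamma> = T"
  proof (intro set_eqI iffI)
    fix A assume "A \<in> facets \<Gamma>"
    then obtain F where "F \<in> T" "A \<subseteq> F" "F = A" by (auto simp: facets_def \<Gamma>_def)
    then show "A \<in> T" by simp
  next
    fix A assume A: "A \<in> T"
    have "B = A" if "B \<in> \<Gamma>" "A \<subseteq> B" for B
    proof -
      from that obtain F where "F \<in> T" "B \<subseteq> F" by (auto simp: \<Gamma>_def)
      with anti[OF A] that show ?thesis by blast
    qed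
    with A show "A \<in> facets \<Gamma>" by (auto simp: facets_def \<Gamma>_def)
  qed
  have "\<Union> T \<subseteq> V"
    using assms(1,2) by (auto simp: facets_def simplicial_complex_def)
  then have "finite (\<Union> T)"
    using assms(1) by (auto simp: simplicial_complex_def intro: finite_subset)
  then have "simplicial_complex (\<Union> T) \<Gamma>"
    using assms(3) unfolding simplicial_complex_def \<Gamma>_def by blast
  with * assms(2) show "subcomplex \<Gamma> \<Delta>" by (auto simp: subcomplex_def)
qed

text \<open>This is \<open>is_leaf\<close> for a bare family of sets, so that leaves can be deleted
  without rebuilding a complex each time.\<close>

definition is_leaf_of :: "'a set set \<Rightarrow> 'a set \<Rightarrow> bool" where
  "is_leaf_of S F \<longleftrightarrow> F \<in> S \<and>
     (S = {F} \<or> (\<exists>G\<in>S. G \<noteq> F \<and> (\<forall>H\<in>S. H \<noteq> F \<longrightarrow> F \<inter> H \<subseteq> F \<inter> G)))"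

lemma simplicial_tree_leaf:
  assumes "simplicial_tree V \<Delta>" "T \<subseteq> facets \<Delta>" "T \<noteq> {}"
  shows "\<exists>F. is_leaf_of T F"
proof -
  have "simplicial_complex V \<Delta>" using assms(1) by (simp add: simplicial_tree_def)
  note sub = subcomplex_spanned_by_facets[OF this assms(2,3)]
  moreover have "{A. \<exists>F\<in>T. A \<subseteq> F} \<noteq> {}" using assms(3) by blast
  ultimately obtain F where "is_leaf {A. \<exists>F\<in>T. A \<subseteq> F} F"
    using assms(1) unfolding simplicial_tree_def by blast
  then show ?thesis unfolding is_leaf_def is_leaf_of_def sub(1) by blast
qed

section \<open>Families of finite sets of equal size\<close>

lemma card_Int_less:
  assumes "finite A" "finite B" "card A = n" "card B = n" "A \<noteq> B"
  shows "card (A \<inter> B) < n"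
proof (rule ccontr)
  assume "\<not> card (A \<inter> B) < n"
  then have "A \<inter> B = A" "A \<inter> B = B"
    using assms by (intro card_seteq; simp)+
  with assms(5) show False by blast
qed

text \<open>Induction on the defect \<open>n - card (A \<inter> B)\<close>: a path in the star of
  \<open>A \<inter> B\<close> replaces one pair by pairs of smaller defect, until the defect is
  1.\<close>

lemma connected_by_stars_imp_adjacent:
  fixes S :: "'a set set"
  assumes card: "\<And>A. A \<in> S \<Longrightarrow> finite A \<and> card A = n"
    and conn: "connected_by (\<lambda>A B. A \<inter> B \<noteq> {}) S"
    and star: "\<And>G A. A \<in> S \<Longrightarrow> G \<subseteq> A \<Longrightarrow> card G + 2 \<le> n \<Longrightarrow>
      connected_by (\<lambda>A B. \<not> A \<inter> B \<subseteq> G) {A \<in> S. G \<subseteq> A}"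
  shows "connected_by (\<lambda>A B. A \<inter> B \<noteq> {} \<and> Suc (card (A \<inter> B)) = card B) S"
proof -
  define E where "E = (\<lambda>A B. A \<in> S \<and> B \<in> S \<and> A \<inter> B \<noteq> {} \<and> Suc (card (A \<inter> B)) = card B)"
  have refine: "E\<^sup>*\<^sup>* A B" if "r\<^sup>*\<^sup>* A B" "\<And>X Y. r X Y \<Longrightarrow> E\<^sup>*\<^sup>* X Y" for r A B
  proof -
    have "r\<^sup>*\<^sup>* \<le> (E\<^sup>*\<^sup>*)\<^sup>*\<^sup>*" by (rule rtranclp_mono) (use that(2) in blast)
    with that(1) show ?thesis by auto
  qed
  have less: "card (A \<inter> B) < n" if "A \<in> S" "B \<in> S" "A \<noteq> B" for A B
    using card that by (intro card_Int_less) auto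
  have "E\<^sup>*\<^sup>* A B" if "A \<in> S" "B \<in> S" for A B
    using that
  proof (induction "n - card (A \<inter> B)" arbitrary: A B rule: less_induct)
    case less': less
    consider "A = B" | "A \<noteq> B" "n \<le> 1"
      | "A \<noteq> B" "n \<ge> 2" "Suc (card (A \<inter> B)) = n" | "card (A \<inter> B) + 2 \<le> n"
      using less[of A B] less'.prems by linarith
    then show ?case
    proof cases
      case 1
      then show ?thesis by simp
    next
      \<comment> \<open>Stars give nothing here, since no \<open>G\<close> satisfies
        \<open>card G + 2 \<le> n\<close>. Distinct members are disjoint, so every step of the path
        supplied by \<open>conn\<close> is trivial.\<close>
      case 2
      have "X = Y" if "X \<in> S \<and> Y \<in> S \<and> X \<inter> Y \<noteq> {}" for X Y
      proof (rule ccontr)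
        assume "X \<noteq> Y"
        with that less[of X Y] 2 have "card (X \<inter> Y) = 0" by auto
        with that card[of X] show False by auto
      qed
      then have "E\<^sup>*\<^sup>* X Y" if "X \<in> S \<and> Y \<in> S \<and> X \<inter> Y \<noteq> {}" for X Y
        using that by blast
      with conn less'.prems refine[of "\<lambda>X Y. X \<in> S \<and> Y \<in> S \<and> X \<inter> Y \<noteq> {}" A B]
      show ?thesis unfolding connected_by_def by blast
    next
      case 3
      \<comment> \<open>The intersection has \<open>n - 1\<close> elements, and
        \<open>n \<ge> 2\<close> keeps this positive.\<close>
      then have "A \<inter> B \<noteq> {}" by auto
      with 3 less'.prems card have "E A B" by (auto simp: E_def)
      then show ?thesis ..
    next
      case 4
      define G where "G = A \<inter> B"
      have "(\<lambda>X Y. X \<in> {A \<in> S. G \<subseteq> A} \<and> Y \<in> {A \<in> S. G \<subseteq> A} \<and> \<not> X \<inter> Y \<subseteq> G)\<^sup>*\<^sup>* A B"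
        using star[of A G] 4 less'.prems by (auto simp: G_def connected_by_def)
      then show ?thesis
      proof (rule refine)
        fix X Y
        assume XY: "X \<in> {A \<in> S. G \<subseteq> A} \<and> Y \<in> {A \<in> S. G \<subseteq> A} \<and> \<not> X \<inter> Y \<subseteq> G"
        then have "G \<subset> X \<inter> Y" by blast
        with XY card have "card G < card (X \<inter> Y)" by (auto intro!: psubset_card_mono)
        then show "E\<^sup>*\<^sup>* X Y" using XY 4 by (intro less'.hyps) (auto simp: G_def)
      qed
    qed
  qed
  then show ?thesis by (simp add: connected_by_def E_def)
qed

text \<open>The leaf hypothesis ranges over all nonempty subfamilies, so it survives the deletion of
  a member. The set \<open>G\<close> stays fixed while \<open>S\<close> shrinks.\<close>

lemma connected_by_adjacent_imp_stars:
  fixes S :: "'a set set"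
  assumes "finite S"
    and "\<And>A. A \<in> S \<Longrightarrow> finite A \<and> card A = n"
    and "\<And>T. T \<subseteq> S \<Longrightarrow> T \<noteq> {} \<Longrightarrow> \<exists>F. is_leaf_of T F"
    and "connected_by (\<lambda>A B. Suc (card (A \<inter> B)) = n) S"
  shows "connected_by (\<lambda>A B. Suc (card (A \<inter> B)) = n) {A \<in> S. G \<subseteq> A}"
  using assms
proof (induction "card S" arbitrary: S rule: less_induct)
  case less
  note card = less.prems(2)
  show ?case
  proof (cases "S = {}")
    case True
    then show ?thesis by (simp add: connected_by_def)
  next
    case False
    with less.prems(3) obtain F where F: "is_leaf_of S F" by blast
    show ?thesis
    proof (cases "S = {F}")
      case True
      then have "A = B" if "A \<in> {A \<in> S. G \<subseteq> A}" "B \<in> {A \<in> S. G \<subseteq> A}" for A B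
        using that by blast
      then show ?thesis unfolding connected_by_def by (metis (lifting) rtranclp.rtrancl_refl)
    next
      case False
      with F obtain J where FS: "F \<in> S" and J: "J \<in> S" "J \<noteq> F"
        "\<And>H. H \<in> S \<Longrightarrow> H \<noteq> F \<Longrightarrow> F \<inter> H \<subseteq> F \<inter> J"
        by (auto simp: is_leaf_of_def)
      have distinct: "card (A \<inter> B) < n" if "A \<in> S" "B \<in> S" "A \<noteq> B" for A B
        using card that by (intro card_Int_less) auto
      \<comment> \<open>The joint property gives one inclusion. The left side has
        \<open>n - 1\<close> elements and the right side at most that many, so they agree.\<close>
      have nbr: "F \<inter> H = F \<inter> J" if H: "H \<in> S" "Suc (card (F \<inter> H)) = n" for H
      proof -
        have "H \<noteq> F"
        proof
          assume "H = F"
          with H card[OF FS] show False by simp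
        qed
        then have "F \<inter> H \<subseteq> F \<inter> J" using H J by blast
        moreover have "card (F \<inter> J) < n" using distinct FS J by blast
        ultimately show ?thesis using H(2) card[OF FS] by (intro card_seteq) simp_all
      qed
      \<comment> \<open>The first step of a path from \<open>F\<close> to \<open>J\<close> reaches a
        neighbour \<open>H\<close> of \<open>F\<close>, and \<open>nbr\<close> turns
        \<open>F \<inter> H\<close> into \<open>F \<inter> J\<close>.\<close>
      have FJ: "Suc (card (F \<inter> J)) = n"
      proof -
        have "(\<lambda>X Y. X \<in> S \<and> Y \<in> S \<and> Suc (card (X \<inter> Y)) = n)\<^sup>*\<^sup>* F J"
          using less.prems(4) FS J by (simp add: connected_by_def)
        then obtain H where "H \<in> S" "Suc (card (F \<inter> H)) = n"
          using J(2) by (auto elim: converse_rtranclpE)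
        with nbr show ?thesis by metis
      qed
      \<comment> \<open>Both \<open>H\<close> and \<open>J\<close> contain the \<open>n - 1\<close>
        elements of \<open>F \<inter> J\<close>, so they are equal or adjacent.\<close>
      have via_J: "H = J \<or> Suc (card (J \<inter> H)) = n"
        if "H \<in> S" "Suc (card (F \<inter> H)) = n" for H
      proof (cases "H = J")
        case False
        have "F \<inter> J \<subseteq> J \<inter> H" using nbr[OF that] by blast
        then have "card (F \<inter> J) \<le> card (J \<inter> H)" using card[OF J(1)] by (intro card_mono) auto
        with distinct[OF J(1) that(1)] FJ False show ?thesis by simp
      qed simp
      define S' where "S' = S - {F}"
      \<comment> \<open>Folding \<open>F\<close> onto \<open>J\<close> and fixing everything else
        sends adjacent sets to equal or adjacent ones; the image of \<open>S\<close> is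
        \<open>S'\<close>.\<close>
      have "connected_by (\<lambda>A B. Suc (card (A \<inter> B)) = n) ((\<lambda>A. if A = F then J else A) ` S)"
        using less.prems(4)
      proof (rule connected_by_image)
        fix A B assume "A \<in> S" "B \<in> S" "Suc (card (A \<inter> B)) = n"
        then show "(if A = F then J else A) = (if B = F then J else B) \<or>
            Suc (card ((if A = F then J else A) \<inter> (if B = F then J else B))) = n"
          using via_J[of A] via_J[of B] by (auto simp: Int_commute)
      qed
      also have "(\<lambda>A. if A = F then J else A) ` S = S'"
        using J FS by (auto simp: S'_def)
      finally have conn': "connected_by (\<lambda>A B. Suc (card (A \<inter> B)) = n) S'" .
      have sub: "S' \<subseteq> S" by (auto simp: S'_def)
      have "card S' < card S"
        unfolding S'_def using less.prems(1) FS by (rule card_Diff1_less)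
      then have IH: "connected_by (\<lambda>A B. Suc (card (A \<inter> B)) = n) {A \<in> S'. G \<subseteq> A}"
      proof (rule less.hyps)
        show "finite S'" using sub less.prems(1) by (rule finite_subset)
        show "finite A \<and> card A = n" if "A \<in> S'" for A using that sub card by blast
        show "\<exists>F. is_leaf_of T F" if "T \<subseteq> S'" "T \<noteq> {}" for T
          using that sub by (intro less.prems(3)) auto
      qed (fact conn')
      let ?E = "\<lambda>X Y. X \<in> {A \<in> S. G \<subseteq> A} \<and> Y \<in> {A \<in> S. G \<subseteq> A} \<and> Suc (card (X \<inter> Y)) = n"
      have rest: "?E\<^sup>*\<^sup>* A B" if "A \<in> {A \<in> S'. G \<subseteq> A}" "B \<in> {A \<in> S'. G \<subseteq> A}" for A B
      proof -
        have "(\<lambda>X Y. X \<in> {A \<in> S'. G \<subseteq> A} \<and> Y \<in> {A \<in> S'. G \<subseteq> A} \<and>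
            Suc (card (X \<inter> Y)) = n)\<^sup>*\<^sup>* A B"
          using IH that unfolding connected_by_def by blast
        then show ?thesis
          by (rule rtranclp_mono[THEN predicate2D, rotated]) (auto simp: S'_def)
      qed
      \<comment> \<open>Any other member \<open>A\<close> of the star forces the joint into it:
        \<open>G \<subseteq> F \<inter> A \<subseteq> F \<inter> J\<close>. Thus \<open>F\<close>
        hangs on the rest of the star by its edge to \<open>J\<close>.\<close>
      have leaf: "?E F J \<and> ?E J F \<and> J \<in> {A \<in> S'. G \<subseteq> A}"
        if "G \<subseteq> F" "A \<in> {A \<in> S'. G \<subseteq> A}" for A
        using that J(3)[of A] J(1,2) FS FJ by (auto simp: S'_def Int_commute)
      show ?thesis
        unfolding connected_by_def
      proof (intro ballI)
        fix A B assume AB: "A \<in> {A \<in> S. G \<subseteq> A}" "B \<in> {A \<in> S. G \<subseteq> A}"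
        consider "A = F" "B = F" | "A = F" "B \<noteq> F" | "A \<noteq> F" "B = F" | "A \<noteq> F" "B \<noteq> F"
          by blast
        then show "?E\<^sup>*\<^sup>* A B"
        proof cases
          case 1
          then show ?thesis by simp
        next
          case 2
          with AB have B: "B \<in> {A \<in> S'. G \<subseteq> A}" and "G \<subseteq> F" by (auto simp: S'_def)
          with leaf have "?E F J" "J \<in> {A \<in> S'. G \<subseteq> A}" by blast+
          from converse_rtranclp_into_rtranclp[of ?E, OF this(1) rest[OF this(2) B]] 2
          show ?thesis by simp
        next
          case 3
          with AB have A: "A \<in> {A \<in> S'. G \<subseteq> A}" and "G \<subseteq> F" by (auto simp: S'_def)
          with leaf have "?E J F" "J \<in> {A \<in> S'. G \<subseteq> A}" by blast+
          from rtranclp.rtrancl_into_rtrancl[of ?E, OF rest[OF A this(2)] this(1)] 3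
          show ?thesis by simp
        next
          case 4
          with AB show ?thesis by (intro rest) (auto simp: S'_def)
        qed
      qed
    qed
  qed
qed

section \<open>Back to the complex\<close>

theorem proposition1p12:
  fixes V :: "'a set" and \<Delta> :: "'a set set" and d :: int
  assumes "simplicial_tree V \<Delta>"
    and "pure_complex \<Delta>"
    and "complex_dim \<Delta> = d"
  shows "(\<forall>G\<in>\<Delta>. face_dim G \<le> d - 2 \<longrightarrow> connected_complex (link \<Delta> G))
           \<longleftrightarrow> connected_in_codim_1 \<Delta>"
proof -
  let ?S = "facets \<Delta>"
  have sc: "simplicial_complex V \<Delta>" and conn: "connected_complex \<Delta>"
    using assms(1) by (auto simp: simplicial_tree_def)
  have "finite \<Delta>" "{} \<in> \<Delta>" and down: "\<And>A B. B \<in> \<Delta> \<Longrightarrow> A \<subseteq> B \<Longrightarrow> A \<in> \<Delta>"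
    and fin: "\<And>A. A \<in> \<Delta> \<Longrightarrow> finite A"
    using sc by (auto simp: simplicial_complex_def intro: finite_subset)
  then have finS: "finite ?S" by (simp add: facets_def)
  obtain F0 where F0: "F0 \<in> ?S" using ex_facet_superset sc \<open>{} \<in> \<Delta>\<close> by metis
  define n where "n = card F0"
  have card: "finite A \<and> card A = n" if "A \<in> ?S" for A
  proof
    from that show "finite A" using fin by (simp add: facets_def)
    have "face_dim A = face_dim F0" using assms(2) F0 that unfolding pure_complex_def by blast
    then show "card A = n" by (simp add: face_dim_def n_def)
  qed
  then have "face_dim ` ?S = {int n - 1}"
    using F0 by (auto simp: face_dim_def image_iff)
  then have "d = int n - 1" using assms(3) by (simp add: complex_dim_def)
  \<comment> \<open>With \<open>d = n - 1\<close>, the bound reads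
    \<open>card G - 1 \<le> n - 3\<close> over the integers; adding 3 on both sides avoids truncated
    subtraction on naturals.\<close>
  then have dim: "face_dim G \<le> d - 2 \<longleftrightarrow> card G + 2 \<le> n" for G :: "'a set"
    by (auto simp: face_dim_def)
  show ?thesis
    unfolding dim connected_complex_link_iff[OF sc] connected_in_codim_1_iff[OF assms(2)]
  proof (intro iffI ballI impI)
    assume star: "\<forall>G\<in>\<Delta>. card G + 2 \<le> n \<longrightarrow>
      connected_by (\<lambda>A B. \<not> A \<inter> B \<subseteq> G) {F \<in> ?S. G \<subseteq> F}"
    have mem: "G \<in> \<Delta>" if "A \<in> ?S" "G \<subseteq> A" for A G
      using that down by (auto simp: facets_def)
    show "connected_by (\<lambda>A B. A \<inter> B \<noteq> {} \<and> Suc (card (A \<inter> B)) = card B) ?S"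
      using card conn[unfolded connected_complex_iff]
      by (rule connected_by_stars_imp_adjacent) (use star mem in blast)+
  next
    fix G
    assume adj: "connected_by (\<lambda>A B. A \<inter> B \<noteq> {} \<and> Suc (card (A \<inter> B)) = card B) ?S"
      and G: "G \<in> \<Delta>" "card G + 2 \<le> n"
    have "connected_by (\<lambda>A B. Suc (card (A \<inter> B)) = n) ?S"
      using adj by (rule connected_by_mono) (use card in auto)
    with finS card simplicial_tree_leaf[OF assms(1)]
    have "connected_by (\<lambda>A B. Suc (card (A \<inter> B)) = n) {F \<in> ?S. G \<subseteq> F}"
      by (intro connected_by_adjacent_imp_stars) auto
    \<comment> \<open>Adjacent facets share \<open>n - 1\<close> vertices, more than the at most
      \<open>n - 2\<close> vertices of \<open>G\<close>, so they meet outside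
      \<open>G\<close>.\<close>
    then show "connected_by (\<lambda>A B. \<not> A \<inter> B \<subseteq> G) {F \<in> ?S. G \<subseteq> F}"
    proof (rule connected_by_mono)
      fix A B :: "'a set" assume "Suc (card (A \<inter> B)) = n"
      then have "\<not> card (A \<inter> B) \<le> card G" using G by simp
      then show "\<not> A \<inter> B \<subseteq> G" using card_mono[OF fin[OF G(1)]] by blast
    qed
  qed
qed

end
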